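(* The only positive integers $n$ of the form $n=2^{\alpha}5^{\beta}$, with integers $\alpha,\beta\geq 0$, that satisfy the congruence $$n\varphi(n)\equiv 2\pmod{\sigma(n)}$$ are $n=1,2,5,8$.
   Context: For a positive integer $n$, $\varphi(n)$ denotes the Euler totient function of $n$ and $\sigma(n)$ denotes the sum of the positive divisors of $n$. *)

theory Defs
  imports "HOL-Number_Theory.Number_Theory"
begin

definition sigma :: "nat \<Rightarrow> nat" where
  "sigma n = (\<Sum>d | d dvd n. d)"

end

theory Submission
  imports Defs
begin

text \<open>
  Put \<open>x = 2^(\<alpha>+1)\<close>, \<open>y = 5^(\<beta>+1)\<close> with \<open>\<alpha>, \<beta> > 0\<close>. The congruence gives
  \<open>x - 1 dvd y^2 - 500\<close> and \<open>(y - 1) div 4 dvd x^2 - 500\<close>. Reduction modulo 3 makes both exponents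
  odd, and then the two divisors are coprime, since a common factor divides 499 while
  \<open>2^249 = -1\<close> modulo 499. Hence \<open>x^2 + y^2 - 501 = k (x - 1) (y - 1)\<close>, where \<open>k\<close> is odd and
  congruent to 2 modulo 3. Vieta jumping in \<open>u = x - 1\<close>, \<open>v = y - 1\<close> descends to a solution with
  \<open>u \<le> 21\<close>, which leaves \<open>k\<close> among 17, 23, 119, 497; no powers of 2 and 5 with odd exponents
  satisfy these equations modulo 91. When \<open>\<alpha> = 0\<close> or \<open>\<beta> = 0\<close>, the divisor sum divides 246 or 15.
\<close>

section \<open>Vieta jumping for \<open>u^2 + 2*u + v^2 + 2*v - 499 = k*u*v\<close>\<close>

text \<open>
  Here \<open>w div u\<close> is the candidate for \<open>k\<close>. The divisor of \<open>499 - u^2 - 2 * u\<close> complementary to \<open>v\<close>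
  is the smaller one, so running over that divisor instead of \<open>v\<close> keeps the table short.
\<close>

lemma small_factor_quotients:
  "\<forall>u\<in>set [1..21::int]. \<forall>e\<in>set [1..22]. (499 - u^2 - 2*u) mod e = 0 \<longrightarrow>
     (let w = (499 - u^2 - 2*u) div e + 2 - e in
       w mod u = 0 \<longrightarrow> w div u \<le> 3 \<or> w div u \<in> {17,23,38,56,93,119,122,246,248,497})"
  by code_simp

text \<open>As a quadratic in \<open>v\<close>, the equation has the second root \<open>-e\<close>,
  so \<open>v * e = 499 - u^2 - 2*u\<close>. Here \<open>0 < e < v\<close>, hence
  \<open>e^2 < 499 < 23^2\<close>, and the finite table recovers \<open>k\<close> from
  \<open>u\<close> and \<open>e\<close>.\<close>

lemma vieta_base:
  fixes k u v :: int
  assumes "k > 3" "0 < u" "u \<le> 21" "0 < v" and eq: "u^2 + 2*u + v^2 + 2*v - 499 = k*u*v"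
  shows "k \<in> {17,23,38,56,93,119,122,246,248,497}"
proof -
  define c e where "c = 499 - u^2 - 2*u" and "e = v + 2 - k*u"
  have c: "c = v * e"
    using eq unfolding c_def e_def by (simp add: algebra_simps power2_eq_square)
  have "u * u \<le> 21 * 21"
    using assms by (intro mult_mono) auto
  then have "c > 0"
    using assms unfolding c_def power2_eq_square by linarith
  then have "e > 0"
    using c \<open>v > 0\<close> by (simp add: zero_less_mult_iff)
  have "k * u \<ge> 4 * 1"
    using assms by (intro mult_mono) auto
  then have "e < v"
    unfolding e_def by linarith
  have "e \<le> 22"
  proof (rule ccontr)
    assume "\<not> e \<le> 22"
    then have "23 * 23 \<le> v * e"
      using \<open>e < v\<close> by (intro mult_mono) auto
    then show False
      using c assms(2) unfolding c_def power2_eq_square by (smt (verit) mult_pos_pos)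
  qed
  have mod: "c mod e = 0" and "c div e = v"
    using c \<open>e > 0\<close> by simp_all
  then have w: "c div e + 2 - e = k*u"
    unfolding e_def by simp
  have "u \<in> set [1..21]" "e \<in> set [1..22]"
    using assms \<open>e > 0\<close> \<open>e \<le> 22\<close> by simp_all
  then have "k*u mod u = 0 \<longrightarrow> k*u div u \<le> 3 \<or> k*u div u \<in> {17,23,38,56,93,119,122,246,248,497}"
    using small_factor_quotients mod w unfolding Let_def c_def by metis
  then show ?thesis
    using assms(1,2) by auto
qed

text \<open>While the smaller entry exceeds 21, the larger one can be exchanged for the other root,
  which is positive and smaller. The sum \<open>u + v\<close> drops, so the descent ends in the
  range of \<open>vieta_base\<close>.\<close>

lemma vieta_descent:
  fixes k u v :: int
  assumes "k > 3" "0 < u" "0 < v" "u^2 + 2*u + v^2 + 2*v - 499 = k*u*v"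
  shows "k \<in> {17,23,38,56,93,119,122,246,248,497}"
  using assms(2-)
proof (induction "nat (u + v)" arbitrary: u v rule: less_induct)
  case less
  have step: "k \<in> {17,23,38,56,93,119,122,246,248,497}"
    if le: "a \<le> b" and pos: "0 < a" "0 < b" and ab: "a + b = u + v"
      and eq: "a^2 + 2*a + b^2 + 2*b - 499 = k*a*b" for a b
  proof (cases "a \<le> 21")
    case True
    then show ?thesis
      using vieta_base[OF assms(1) pos(1) True pos(2) eq] by blast
  next
    case False
    \<comment> \<open>the other root of the equation, read as a quadratic in \<open>b\<close>\<close>
    define b' where "b' = k*a - 2 - b"
    have prod: "b * b' = a^2 + 2*a - 499"
      using eq unfolding b'_def by (simp add: algebra_simps power2_eq_square)
    have "a * a \<ge> 22 * 22"
      using False by (intro mult_mono) auto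
    then have "b * b' > 0"
      using False unfolding prod power2_eq_square by linarith
    then have "b' > 0"
      using pos by (simp add: zero_less_mult_iff)
    \<comment> \<open>Otherwise \<open>b' \<le> a + 1\<close> from the product of the roots, so
      their sum \<open>k*a - 2\<close> would be at most \<open>2*a + 2\<close>, too small for
      \<open>k \<ge> 4\<close>.\<close>
    have "b' < b"
    proof (rule ccontr)
      assume "\<not> b' < b"
      then have "a * b' \<le> b * b'" 
        using le \<open>b' > 0\<close> by simp
      then have "a * b' < a * (a + 2)"
        unfolding prod by (simp add: algebra_simps power2_eq_square)
      then have "b' < a + 2"
        using pos by simp
      moreover have "k * a \<ge> 4 * a"
        using assms(1) pos by simp
      ultimately show False
        using \<open>\<not> b' < b\<close> False unfolding b'_def by linarith
    qed
    moreover have "a^2 + 2*a + b'^2 + 2*b' - 499 = k*a*b'"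
      using prod unfolding b'_def by (simp add: algebra_simps power2_eq_square)
    ultimately show ?thesis
      using less.hyps[of a b'] pos ab \<open>b' > 0\<close> by simp
  qed
  show ?case
  proof (cases "u \<le> v")
    case True
    then show ?thesis
      using step less.prems by blast
  next
    case False
    then show ?thesis
      using step[of v u] less.prems by (simp add: algebra_simps)
  qed
qed

section \<open>Odd powers of 2 and 5 modulo 91\<close>

text \<open>The six residues are the orbit of 2 under multiplication by 4, which has order 6 modulo
  91.\<close>

lemma odd_power_2_mod_91:
  assumes "odd a"
  shows "(2::int)^a mod 91 \<in> {2, 8, 32, 37, 57, 46}"
proof -
  obtain m where "a = 2*m + 1"
    using assms by (elim oddE)
  moreover have "(2::int)^(2*m+1) mod 91 \<in> {2, 8, 32, 37, 57, 46}"
  proof (induction m)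
    case (Suc m)
    have "(2::int)^(2 * Suc m + 1) mod 91 = 4 * (2^(2*m+1) mod 91) mod 91"
      by (simp add: mod_simps)
    then show ?case
      using Suc by auto
  qed simp
  ultimately show ?thesis by simp
qed

lemma odd_power_5_mod_91:
  assumes "odd b"
  shows "(5::int)^b mod 91 \<in> {5, 34, 31, 47, 83, 73}"
proof -
  obtain m where "b = 2*m + 1"
    using assms by (elim oddE)
  moreover have "(5::int)^(2*m+1) mod 91 \<in> {5, 34, 31, 47, 83, 73}"
  proof (induction m)
    case (Suc m)
    have "(5::int)^(2 * Suc m + 1) mod 91 = 25 * (5^(2*m+1) mod 91) mod 91"
      by (simp add: mod_simps)
    then show ?case
      using Suc by auto
  qed simp
  ultimately show ?thesis by simp
qed

lemma no_residues_mod_91: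
  "\<forall>k\<in>{17, 23, 119, 497::int}. \<forall>x\<in>{2, 8, 32, 37, 57, 46}. \<forall>y\<in>{5, 34, 31, 47, 83, 73}.
     (x^2 + y^2 - 501) mod 91 \<noteq> (k * (x - 1) * (y - 1)) mod 91"
  by code_simp

lemma no_powers_mod_91:
  fixes k :: int
  assumes "odd a" "odd b" "k \<in> {17, 23, 119, 497}"
  shows "((2::int)^a)^2 + (5^b)^2 - 501 \<noteq> k * (2^a - 1) * (5^b - 1)"
proof
  define x y :: int where "x = 2^a mod 91" and "y = 5^b mod 91"
  assume "((2::int)^a)^2 + (5^b)^2 - 501 = k * (2^a - 1) * (5^b - 1)"
  then have "(((2::int)^a)^2 + (5^b)^2 - 501) mod 91 = (k * (2^a - 1) * (5^b - 1)) mod 91"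
    by simp
  moreover have "(((2::int)^a)^2 + (5^b)^2 - 501) mod 91 = (x^2 + y^2 - 501) mod 91"
    unfolding x_def y_def by (intro mod_diff_cong mod_add_cong refl) (simp_all add: power_mod)
  moreover have "(k * (2^a - 1) * (5^b - 1)) mod 91 = (k * (x - 1) * (y - 1)) mod 91"
    unfolding x_def y_def by (intro mod_mult_cong mod_diff_cong refl) simp_all
  ultimately have "(x^2 + y^2 - 501) mod 91 = (k * (x - 1) * (y - 1)) mod 91"
    by simp
  moreover have "x \<in> {2, 8, 32, 37, 57, 46}" "y \<in> {5, 34, 31, 47, 83, 73}"
    unfolding x_def y_def using assms odd_power_2_mod_91 odd_power_5_mod_91 by blast+
  ultimately show False
    using assms(3) no_residues_mod_91 by blast
qed

section \<open>The prime 499, and powers modulo 3 and 8\<close>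

text \<open>Modulo the gcd, \<open>2^(249*a)\<close> is 1 as a power of \<open>2^a\<close>, and -1
  as an odd power of \<open>2^249\<close>. So the gcd divides 2 and the odd number 499.\<close>

lemma coprime_mersenne_odd_499:
  assumes "odd a"
  shows "coprime ((2::int)^a - 1) 499"
proof -
  define g where "g = gcd ((2::int)^a - 1) 499"
  have "[(2::int)^a = 1] (mod g)"
    unfolding g_def by (simp add: cong_iff_dvd_diff)
  moreover have "(499::int) dvd 2^249 - (-1)"
    by simp
  then have "[(2::int)^249 = -1] (mod g)"
    unfolding g_def cong_iff_dvd_diff by (meson dvd_trans gcd_dvd2)
  ultimately have "[(2^a)^249 = (1::int)^249] (mod g)" "[(2^249)^a = (-1::int)^a] (mod g)"
    by (blast intro: cong_pow)+
  moreover have "((2::int)^a)^249 = (2^249)^a"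
    by (metis power_mult mult.commute)
  ultimately have "[1 = (-1::int)] (mod g)"
    using assms by (metis cong_sym cong_trans power_one uminus_power_if)
  then have "g dvd 2"
    by (simp add: cong_iff_dvd_diff)
  moreover have "g dvd 499"
    unfolding g_def by simp
  ultimately have "g dvd 499 - 249 * 2"
    by (metis dvd_diff dvd_mult)
  then show ?thesis
    unfolding g_def coprime_iff_gcd_eq_1 by simp
qed

lemma power_int_mod_3:
  fixes q :: int
  assumes "q mod 3 = 2"
  shows "q^a mod 3 = (if even a then 1 else 2)"
proof (induction a)
  case (Suc a)
  have "q^Suc a mod 3 = (q mod 3) * (q^a mod 3) mod 3"
    by (simp add: mod_simps)
  then show ?case
    using Suc assms by auto
qed simp

lemma odd_power_5_mod_8:
  assumes "odd b"
  shows "(5::int)^b mod 8 = 5"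
proof -
  obtain m where "b = 2*m + 1"
    using assms by (elim oddE)
  moreover have "(25::int)^m mod 8 = 1"
    using power_mod[of "25::int" 8 m] by simp
  then have "5 * (25::int)^m mod 8 = 5"
    using mod_mult_right_eq[of "5::int" "25^m" 8] by simp
  ultimately show ?thesis
    by (simp add: power_mult)
qed

section \<open>Divisor sums of prime powers and of coprime products\<close>

text \<open>Multiplication is a bijection from pairs of divisors of \<open>a\<close> and
  \<open>b\<close> onto the divisors of \<open>a * b\<close>.\<close>

lemma sigma_mult_coprime:
  assumes "coprime a b"
  shows "sigma (a * b) = sigma a * sigma b"
proof -
  have inj: "inj_on (\<lambda>(c, d). c * d) ({c. c dvd a} \<times> {d. d dvd b})"
  proof (rule inj_onI, clarify)
    fix c d c' d'
    assume dvd: "c dvd a" "d dvd b" "c' dvd a" "d' dvd b" and eq: "c * d = c' * d'"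
    have "coprime c d'" "coprime c' d"
      using assms dvd by (meson coprime_divisors)+
    then show "c = c' \<and> d = d'"
      using eq coprime_crossproduct_nat by (metis mult.commute)
  qed
  have img: "(\<lambda>(c, d). c * d) ` ({c. c dvd a} \<times> {d. d dvd b}) = {d. d dvd a * b}"
    by (auto intro: mult_dvd_mono elim!: dvd_productE)
  show ?thesis
    unfolding sigma_def sum_product sum.cartesian_product img[symmetric]
    by (subst sum.reindex[OF inj]) (simp add: case_prod_unfold)
qed

lemma sigma_prime_power:
  assumes "prime p"
  shows "(p - 1) * sigma (p ^ a) = p ^ (a + 1) - 1"
proof -
  have "{d. d dvd p ^ a} = (\<lambda>i. p ^ i) ` {..a}"
    using divides_primepow_nat[OF assms] by auto
  moreover have "inj_on (\<lambda>i. p ^ i) {..a}"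
    using prime_gt_1_nat[OF assms] by (auto intro: inj_onI)
  ultimately have "sigma (p ^ a) = (\<Sum>i\<le>a. p ^ i)"
    unfolding sigma_def by (simp add: sum.reindex)
  moreover have "int ((p - 1) * (\<Sum>i\<le>a. p ^ i)) = int (p ^ (a + 1) - 1)"
    using prime_gt_1_nat[OF assms] power_diff_1_eq[of "int p" "a + 1"]
    by (simp add: of_nat_diff lessThan_Suc_atMost)
  ultimately show ?thesis
    by (metis of_nat_eq_iff)
qed

lemma sigma_power_2: "int (sigma (2 ^ a)) = 2 ^ (a + 1) - 1"
  using sigma_prime_power[of 2 a] by (simp add: of_nat_diff)

lemma sigma_power_5: "4 * int (sigma (5 ^ b)) = 5 ^ (b + 1) - 1"
proof -
  have "4 * sigma (5 ^ b) = 5 ^ (b + 1) - 1"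
    using sigma_prime_power[of 5 b] by simp
  then have "int (4 * sigma (5 ^ b)) = int (5 ^ (b + 1) - 1)"
    by (rule arg_cong)
  then show ?thesis
    by (simp add: of_nat_diff)
qed

lemma sigma_2_5: "sigma (2 ^ a * 5 ^ b) = sigma (2 ^ a) * sigma (5 ^ b)"
  by (rule sigma_mult_coprime) (simp add: coprime_power_left_iff coprime_power_right_iff)

section \<open>Both exponents positive\<close>

lemma no_solution_mixed:
  assumes "a > 0" "b > 0"
  shows "\<not> [(2 ^ a * 5 ^ b) * totient (2 ^ a * 5 ^ b) = 2] (mod (sigma (2 ^ a * 5 ^ b)))"
proof
  define x y M N :: int where "x = 2 ^ (a + 1)" and "y = 5 ^ (b + 1)"
    and "M = int (sigma (2 ^ a))" and "N = int (sigma (5 ^ b))"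
  have M: "M = x - 1" and N: "4 * N = y - 1"
    unfolding M_def N_def x_def y_def using sigma_power_2 sigma_power_5 by blast+
  assume "[(2 ^ a * 5 ^ b) * totient (2 ^ a * 5 ^ b) = 2] (mod (sigma (2 ^ a * 5 ^ b)))"
  then have "[int ((2 ^ a * 5 ^ b) * totient (2 ^ a * 5 ^ b)) = int 2] (mod (int (sigma (2 ^ a * 5 ^ b))))"
    by (simp only: cong_int_iff)
  then have "M * N dvd int ((2 ^ a * 5 ^ b) * totient (2 ^ a * 5 ^ b)) - 2"
    unfolding M_def N_def sigma_2_5 by (simp add: cong_iff_dvd_diff)
  \<comment> \<open>With \<open>n = 2^a * 5^b\<close>, the totient is \<open>2*n/5\<close> and
    \<open>x*y = 10*n\<close>; the factor 250 turns \<open>n\<close> times its totient into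
    \<open>x^2 * y^2\<close>.\<close>
  then have "M * N dvd 250 * (int ((2 ^ a * 5 ^ b) * totient (2 ^ a * 5 ^ b)) - 2)"
    by (rule dvd_mult)
  moreover have "250 * int ((2 ^ a * 5 ^ b) * totient (2 ^ a * 5 ^ b)) = x^2 * y^2"
  proof -
    obtain a' b' where ab: "a = Suc a'" "b = Suc b'"
      using assms by (auto simp: gr0_conv_Suc)
    have "totient (2 ^ a * 5 ^ b) = 2 ^ a' * (5 ^ b' * 4)"
      unfolding ab by (subst totient_mult_coprime)
        (simp_all add: totient_prime_power_Suc coprime_power_left_iff coprime_power_right_iff del: power_Suc)
    then show ?thesis
      unfolding x_def y_def ab by (simp add: power2_eq_square)
  qed
  ultimately have dvd: "M * N dvd x^2 * y^2 - 500"
    by (simp add: algebra_simps)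

  have "x - 1 dvd y^2 - 500"
  proof -
    have "x - 1 dvd (x^2 * y^2 - 500) - (x - 1) * (x + 1) * y^2"
      using dvd_mult_left[OF dvd] unfolding M by (rule dvd_diff) (simp add: mult.assoc)
    then show ?thesis
      by (simp add: algebra_simps power2_eq_square)
  qed
  have "N dvd x^2 - 500"
  proof -
    have "N dvd (x^2 * y^2 - 500) - N * (4 * (y + 1) * x^2)"
      using dvd_mult_right[OF dvd] by (rule dvd_diff) simp
    also have "N * (4 * (y + 1) * x^2) = (y - 1) * (y + 1) * x^2"
      unfolding N[symmetric] by simp
    finally show ?thesis
      by (simp add: algebra_simps power2_eq_square)
  qed

  have x3: "x mod 3 = (if odd a then 1 else 2)" and y3: "y mod 3 = (if odd b then 1 else 2)"
    unfolding x_def y_def using power_int_mod_3[of 2 "a+1"] power_int_mod_3[of 5 "b+1"] by simp_all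
  have sq: "x^2 mod 3 = 1" "y^2 mod 3 = 1"
    using x3 y3 by (auto simp flip: power_mod[of x] power_mod[of y])
  have "even a"
  proof (rule ccontr)
    assume "odd a"
    then have "3 dvd x - 1"
      using x3 by presburger
    then have "3 dvd y^2 - 500"
      using \<open>x - 1 dvd y^2 - 500\<close> dvd_trans by blast
    then show False
      using sq by presburger
  qed
  have "even b"
  proof (rule ccontr)
    assume "odd b"
    then have "3 dvd N"
      using y3 N by presburger
    then have "3 dvd x^2 - 500"
      using \<open>N dvd x^2 - 500\<close> dvd_trans by blast
    then show False
      using sq by presburger
  qed

  have "coprime M N"
  proof (rule coprimeI)
    fix c assume c: "c dvd M" "c dvd N"
    have "N dvd y - 1"
      unfolding N[symmetric] by simp
    then have "c dvd (y - 1) * (y + 1)" "c dvd y^2 - 500"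
      using c \<open>x - 1 dvd y^2 - 500\<close> unfolding M by (meson dvd_mult2 dvd_trans)+
    then have "c dvd (y - 1) * (y + 1) - (y^2 - 500)"
      by (rule dvd_diff)
    then have "c dvd 499"
      by (simp add: algebra_simps power2_eq_square)
    moreover have "coprime M 499"
      unfolding M x_def using coprime_mersenne_odd_499[of "a + 1"] \<open>even a\<close> by simp
    ultimately show "is_unit c"
      using c coprime_common_divisor by blast
  qed
  \<comment> \<open>Adding multiples of \<open>M\<close> and \<open>N\<close> gives both divisors
    the same target \<open>x^2 + y^2 - 501\<close>.\<close>
  moreover have "M dvd (y^2 - 500) + (x - 1) * (x + 1)" "N dvd (x^2 - 500) + N * (4 * (y + 1))"
    using \<open>x - 1 dvd y^2 - 500\<close> \<open>N dvd x^2 - 500\<close> unfolding M by simp_all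
  moreover have "(y^2 - 500) + (x - 1) * (x + 1) = x^2 + y^2 - 501"
    by (simp add: algebra_simps power2_eq_square)
  moreover have "(x^2 - 500) + N * (4 * (y + 1)) = (x^2 - 500) + (4 * N) * (y + 1)"
    by simp
  then have "(x^2 - 500) + N * (4 * (y + 1)) = x^2 + y^2 - 501"
    unfolding N by (simp add: algebra_simps power2_eq_square)
  ultimately have "M * N dvd x^2 + y^2 - 501"
    by (metis divides_mult)
  then obtain l where l: "x^2 + y^2 - 501 = M * N * l"
    by (elim dvdE)

  have "3 \<le> a + 1"
    using \<open>a > 0\<close> \<open>even a\<close> by presburger
  then have "(2::int) ^ 3 dvd x"
    unfolding x_def by (rule le_imp_power_dvd)
  then have x8: "x mod 8 = 0"
    by simp
  have y8: "y mod 8 = 5"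
    unfolding y_def using odd_power_5_mod_8[of "b + 1"] \<open>even b\<close> by simp
  \<comment> \<open>\<open>y - 1\<close> is 4 modulo 8, so its quarter \<open>N\<close> is odd. All
    factors 2 of \<open>x^2 + y^2 - 501\<close> then lie in \<open>l\<close>, exactly two of them,
    which makes \<open>k\<close> odd.\<close>
  have "odd (M * N)"
    using x8 y8 M N by (simp, presburger)
  have "x^2 mod 8 = 0" "y^2 mod 8 = 1"
    using x8 y8 by (simp_all flip: power_mod[of x] power_mod[of y])
  then have mod8: "(M * N * l) mod 8 = 4"
    unfolding l[symmetric] by presburger
  have "coprime 4 (M * N)"
    using \<open>odd (M * N)\<close> coprime_power_left_iff[of 2 2 "M * N"] by simp
  moreover have "4 dvd M * N * l"
    using mod8 by presburger
  ultimately have "4 dvd l"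
    using coprime_dvd_mult_right_iff by blast
  then obtain k where k: "l = 4 * k"
    by (elim dvdE)
  have "odd k"
  proof
    assume "even k"
    then have "8 dvd M * N * l"
      unfolding k by auto
    then show False
      using mod8 by presburger
  qed
  have eq: "x^2 + y^2 - 501 = k * (x - 1) * (y - 1)"
    unfolding l k N[symmetric] M by simp

  have "x \<ge> 8" "y \<ge> 25"
    unfolding x_def y_def using power_increasing[of 3 "a+1" "2::int"] \<open>3 \<le> a + 1\<close>
      power_increasing[of 2 "b+1" "5::int"] \<open>b > 0\<close> by auto
  then have "y * y \<ge> 25 * 25"
    by (intro mult_mono) auto
  then have "k * ((x - 1) * (y - 1)) > 0"
    using eq by (simp add: power2_eq_square algebra_simps) (smt (verit) zero_le_square)
  moreover have "(x - 1) * (y - 1) > 0"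
    using \<open>x \<ge> 8\<close> \<open>y \<ge> 25\<close> by simp
  ultimately have "k > 0"
    by (simp add: zero_less_mult_iff)
  \<comment> \<open>Modulo 3 both \<open>x - 1\<close> and \<open>y - 1\<close> are 1, while
    \<open>x^2 + y^2 - 501\<close> is 2. Being odd and positive, \<open>k\<close> is then at least
    5.\<close>
  have "k mod 3 = 2"
  proof -
    have "(x - 1) mod 3 = 1" "(y - 1) mod 3 = 1"
      using x3 y3 \<open>even a\<close> \<open>even b\<close> by (simp, presburger)+
    then have "(k * (x - 1) * (y - 1)) mod 3 = k mod 3"
      by (metis mod_mult_right_eq mult.right_neutral)
    then show ?thesis
      unfolding eq[symmetric] using sq by presburger
  qed
  then have "k > 3"
    using \<open>odd k\<close> \<open>k > 0\<close> by presburger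
  moreover have "(x-1)^2 + 2*(x-1) + (y-1)^2 + 2*(y-1) - 499 = k*(x-1)*(y-1)"
    unfolding eq[symmetric] by (simp add: algebra_simps power2_eq_square)
  ultimately have "k \<in> {17,23,38,56,93,119,122,246,248,497}"
    using vieta_descent[of k "x - 1" "y - 1"] \<open>x \<ge> 8\<close> \<open>y \<ge> 25\<close> by linarith
  \<comment> \<open>Parity removes all other candidates except 93, which is divisible by 3.\<close>
  then have "k \<in> {17, 23, 119, 497}"
    using \<open>odd k\<close> \<open>k mod 3 = 2\<close> by auto
  then show False
    using no_powers_mod_91[of "a + 1" "b + 1" k] \<open>even a\<close> \<open>even b\<close> eq
    unfolding x_def y_def by simp
qed

section \<open>Pure powers of 2 and of 5\<close>

lemma solution_power_2:
  assumes "[2 ^ a * totient (2 ^ a) = 2] (mod (sigma (2 ^ a)))"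
  shows "a = 0 \<or> a = 1 \<or> a = 3"
proof (cases a)
  case (Suc a')
  define x :: int where "x = 2 ^ (a + 1)"
  have "[int (2 ^ a * totient (2 ^ a)) = int 2] (mod (int (sigma (2 ^ a))))"
    using assms by (simp only: cong_int_iff)
  then have "x - 1 dvd int (2 ^ a * totient (2 ^ a)) - 2"
    unfolding x_def sigma_power_2 by (simp add: cong_iff_dvd_diff)
  \<comment> \<open>For \<open>a > 0\<close>, \<open>2^a\<close> times its totient is
    \<open>x^2 / 8\<close>, so the scaled difference is \<open>x^2 - 16\<close>, which is -15 modulo
    \<open>x - 1\<close>.\<close>
  then have "x - 1 dvd 8 * (int (2 ^ a * totient (2 ^ a)) - 2)"
    by (rule dvd_mult)
  also have "8 * (int (2 ^ a * totient (2 ^ a)) - 2) = (x - 1) * (x + 1) - 15"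
    unfolding x_def Suc by (simp add: totient_prime_power_Suc algebra_simps power2_eq_square del: power_Suc)
      (simp add: power_Suc)
  finally have dvd: "x - 1 dvd 15"
    by (metis dvd_diff_right_iff dvd_triv_left)
  then have "x \<le> 2 ^ 4"
    using zdvd_imp_le[OF dvd] by simp
  then have "a + 1 \<le> 4"
    unfolding x_def using power_increasing_iff[of "2::int" "a + 1" 4] by simp
  then have "a \<in> {0, 1, 2, 3}"
    by auto
  \<comment> \<open>Only \<open>a = 2\<close> has to be excluded: 7 does not divide 15.\<close>
  then show ?thesis
    using dvd unfolding x_def by auto
qed simp

lemma solution_power_5:
  assumes "[5 ^ b * totient (5 ^ b) = 2] (mod (sigma (5 ^ b)))"
  shows "b = 0 \<or> b = 1"
proof (cases b)
  case (Suc b')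
  define y N :: int where "y = 5 ^ (b + 1)" and "N = int (sigma (5 ^ b))"
  have N: "4 * N = y - 1"
    unfolding N_def y_def by (rule sigma_power_5)
  have "[int (5 ^ b * totient (5 ^ b)) = int 2] (mod N)"
    unfolding N_def using assms by (simp only: cong_int_iff)
  then have "N dvd int (5 ^ b * totient (5 ^ b)) - 2"
    by (simp add: cong_iff_dvd_diff)
  \<comment> \<open>Here \<open>5^b\<close> times its totient is \<open>4*y^2 / 125\<close>, so the
    scaled difference is \<open>4*y^2 - 250\<close>, which is -246 modulo \<open>N\<close>.\<close>
  then have "N dvd 125 * (int (5 ^ b * totient (5 ^ b)) - 2)"
    by (rule dvd_mult)
  also have "125 * (int (5 ^ b * totient (5 ^ b)) - 2) = 4 * ((y - 1) * (y + 1)) - 246"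
    unfolding y_def Suc by (simp add: totient_prime_power_Suc algebra_simps power2_eq_square del: power_Suc)
      (simp add: power_Suc)
  also have "4 * ((y - 1) * (y + 1)) - 246 = N * (16 * (y + 1)) - 246"
    unfolding N[symmetric] by simp
  finally have dvd: "N dvd 246"
    by (metis dvd_diff_right_iff dvd_triv_left)
  then have "N \<le> 246"
    by (rule zdvd_imp_le) simp
  then have "y < 5 ^ 5"
    using N by simp
  then have "b + 1 < 5"
    unfolding y_def using power_strict_increasing_iff[of "5::int" "b + 1" 5] by simp
  then have "b \<in> {0, 1, 2, 3}"
    by auto
  \<comment> \<open>For \<open>b = 2\<close> and \<open>b = 3\<close>, \<open>y - 1\<close> is 124
    and 624, neither of which divides 984.\<close>
  moreover have "(y - 1) dvd 984"
    unfolding N[symmetric] using mult_dvd_mono[OF dvd_refl[of 4] dvd] by simp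
  ultimately show ?thesis
    unfolding y_def by auto
qed simp

section \<open>Assembling the cases and checking the four solutions\<close>

theorem theorem1:
  shows "{n :: nat. (\<exists>\<alpha> \<beta> :: nat. n = 2 ^ \<alpha> * 5 ^ \<beta>) \<and> [n * totient n = 2] (mod (sigma n))}
         = {1, 2, 5, 8}"
proof (intro subset_antisym subsetI)
  fix n :: nat
  assume "n \<in> {n. (\<exists>\<alpha> \<beta> :: nat. n = 2 ^ \<alpha> * 5 ^ \<beta>) \<and> [n * totient n = 2] (mod (sigma n))}"
  then obtain a b where n: "n = 2 ^ a * 5 ^ b" and cong: "[n * totient n = 2] (mod (sigma n))"
    by blast
  consider "a > 0" "b > 0" | "a = 0" | "b = 0"
    by blast
  then show "n \<in> {1, 2, 5, 8}"
  proof cases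
    case 1
    then show ?thesis
      using no_solution_mixed cong unfolding n by blast
  next
    case 2
    then show ?thesis
      using solution_power_5[of b] cong unfolding n by auto
  next
    case 3
    then show ?thesis
      using solution_power_2[of a] cong unfolding n by auto
  qed
next
  have s: "sigma 1 = 1" "sigma 2 = 3" "sigma 8 = 15" "sigma 5 = 6"
    using sigma_power_2[of 0] sigma_power_2[of 1] sigma_power_2[of 3] sigma_power_5[of 1] by simp_all
  have t: "totient 2 = 1" "totient 8 = 4" "totient 5 = 4"
    using totient_prime[of 2] totient_prime_power[of 2 3] totient_prime[of 5] by simp_all
  fix n :: nat
  assume "n \<in> {1, 2, 5, 8}"
  then consider "n = 2^0 * 5^0" | "n = 2^1 * 5^0" | "n = 2^0 * 5^1" | "n = 2^3 * 5^0"
    by auto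
  then have "\<exists>\<alpha> \<beta> :: nat. n = 2 ^ \<alpha> * 5 ^ \<beta>"
    by cases blast+
  moreover have "[n * totient n = 2] (mod (sigma n))"
    using \<open>n \<in> {1, 2, 5, 8}\<close> s t by (auto simp: cong_def simp del: One_nat_def)
  ultimately show "n \<in> {n. (\<exists>\<alpha> \<beta> :: nat. n = 2 ^ \<alpha> * 5 ^ \<beta>) \<and> [n * totient n = 2] (mod (sigma n))}"
    by blast
qed

end
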